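(* Let $(A,B)$ be a table algebra, let $C$ be a strongly normal closed subset of $B$, and let $e=|C^+|^{-1}C^+$. Let $\chi$ be an irreducible character of $A$ such that $\chi(e)\neq 0$, and let $\psi$ be a character of $A$. Then $\chi\psi$ is a character of $A$.
   Context: A table algebra $(A,B)$ (not necessarily commutative) is a finite-dimensional associative unital algebra $A$ over $\mathbb{C}$ with a distinguished basis $B=\{b_1=1_A,\dots,b_d\}$ such that: (I) for $a,b\in B$, $ab=\sum_{c\in B}\lambda_{abc}c$ with all $\lambda_{abc}$ nonnegative real numbers; (II) there is a semilinear (conjugate-linear) involutory anti-automorphism $^*$ of $A$ with $B^*=B$; (III) for $a,b\in B$, $\lambda_{ab1_A}=\delta_{ab^*}|a|$ with $|a|>0$, where $\delta_{ab^*}$ is $1$ if $a=b^*$ and $0$ otherwise; (IV) the map $b\mapsto|b|$, $b\in B$, extends linearly to a one-dimensional representation of $A$ (the degree map), and $|b|=|b^*|$ for all $b\in B$. For $x=\sum_{b\in B}x_bb\in A$, $|x|=\sum_b x_b|b|$ and $\mathrm{Supp}(x)=\{b\in B:x_b\ne0\}$. For $E,D\subseteq B$, $ED=\bigcup_{e\in E,d\in D}\mathrm{Supp}(ed)$ (a single element $b$ stands for $\{b\}$), $E^*=\{e^*:e\in E\}$, and $E^+=\sum_{x\in E}x\in A$. A nonempty subset $C\subseteq B$ is closed if $C^*C\subseteq C$. A closed subset $C$ is strongly normal if $b^*Cb\subseteq C$ for every $b\in B$. A character of $A$ is the trace function $A\to\mathbb{C}$ of a finite-dimensional representation of $A$;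 it is irreducible if the representation is irreducible. For characters $\chi,\psi$ of $A$, the product $\chi\psi$ is the linear functional on $A$ defined by $\chi\psi(b)=\frac{1}{|b|}\chi(b)\psi(b)$ for $b\in B$. *)

theory Defs
  imports "HOL-Library.Nonpos_Ints" "Jordan_Normal_Form.VS_Connect"
begin

text \<open>
  The algebra is the whole type \<open>'a\<close>, with scalar multiplication \<open>scale\<close>; \<open>B\<close> is the distinguished
  basis and \<open>deg b\<close> is $|b|$ (only its values on \<open>B\<close> matter).  The coordinate of \<open>x\<close> at \<open>b\<close> is
  \<open>coord scale B x b\<close>, so the structure constant $\lambda_{abc}$ is \<open>coord scale B (a * b) c\<close>.
\<close>

abbreviation coord :: "(complex \<Rightarrow> 'a::ring_1 \<Rightarrow> 'a) \<Rightarrow> 'a set \<Rightarrow> 'a \<Rightarrow> 'a \<Rightarrow> complex" where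
  "coord scale B \<equiv> module.representation scale B"

definition deg_map ::
  "(complex \<Rightarrow> 'a::ring_1 \<Rightarrow> 'a) \<Rightarrow> 'a set \<Rightarrow> ('a \<Rightarrow> real) \<Rightarrow> 'a \<Rightarrow> complex" where
  "deg_map scale B deg x = (\<Sum>b\<in>B. coord scale B x b * complex_of_real (deg b))"

locale table_algebra = finite_dimensional_vector_space scale B
  for scale :: "complex \<Rightarrow> 'a::ring_1 \<Rightarrow> 'a" and B :: "'a set" +
  fixes star :: "'a \<Rightarrow> 'a" and deg :: "'a \<Rightarrow> real"
  assumes scale_mult_left: "scale k x * y = scale k (x * y)"
    and scale_mult_right: "x * scale k y = scale k (x * y)"
    and one_in_B: "1 \<in> B"
    and structure_constants_nonneg:
      "a \<in> B \<Longrightarrow> b \<in> B \<Longrightarrow> c \<in> B \<Longrightarrow> coord scale B (a * b) c \<in> \<real>\<^sub>\<ge>\<^sub>0"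
    and star_add: "star (x + y) = star x + star y"
    and star_scale: "star (scale k x) = scale (cnj k) (star x)"
    and star_mult: "star (x * y) = star y * star x"
    and star_star: "star (star x) = x"
    and star_B: "star ` B = B"
    and coord_one: "a \<in> B \<Longrightarrow> b \<in> B \<Longrightarrow>
      coord scale B (a * b) 1 = (if a = star b then complex_of_real (deg a) else 0)"
    and deg_pos: "b \<in> B \<Longrightarrow> deg b > 0"
    and deg_map_mult: "deg_map scale B deg (x * y) = deg_map scale B deg x * deg_map scale B deg y"
    and deg_map_one: "deg_map scale B deg 1 = 1"
    and deg_star: "b \<in> B \<Longrightarrow> deg (star b) = deg b"

definition supp :: "(complex \<Rightarrow> 'a::ring_1 \<Rightarrow> 'a) \<Rightarrow> 'a set \<Rightarrow> 'a \<Rightarrow> 'a set" where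
  "supp scale B x = {b \<in> B. coord scale B x b \<noteq> 0}"

definition cprod ::
  "(complex \<Rightarrow> 'a::ring_1 \<Rightarrow> 'a) \<Rightarrow> 'a set \<Rightarrow> 'a set \<Rightarrow> 'a set \<Rightarrow> 'a set" where
  "cprod scale B E D = (\<Union>e\<in>E. \<Union>d\<in>D. supp scale B (e * d))"

definition closed_subset ::
  "(complex \<Rightarrow> 'a::ring_1 \<Rightarrow> 'a) \<Rightarrow> 'a set \<Rightarrow> ('a \<Rightarrow> 'a) \<Rightarrow> 'a set \<Rightarrow> bool" where
  "closed_subset scale B star C \<longleftrightarrow>
     C \<noteq> {} \<and> C \<subseteq> B \<and> cprod scale B (star ` C) C \<subseteq> C"

definition strongly_normal ::
  "(complex \<Rightarrow> 'a::ring_1 \<Rightarrow> 'a) \<Rightarrow> 'a set \<Rightarrow> ('a \<Rightarrow> 'a) \<Rightarrow> 'a set \<Rightarrow> bool" where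
  "strongly_normal scale B star C \<longleftrightarrow>
     closed_subset scale B star C \<and>
     (\<forall>b\<in>B. cprod scale B (cprod scale B {star b} C) {b} \<subseteq> C)"

definition closed_idem ::
  "(complex \<Rightarrow> 'a::ring_1 \<Rightarrow> 'a) \<Rightarrow> 'a set \<Rightarrow> ('a \<Rightarrow> real) \<Rightarrow> 'a set \<Rightarrow> 'a" where
  "closed_idem scale B deg C = scale (inverse (deg_map scale B deg (\<Sum>C))) (\<Sum>C)"

text \<open>
  A finite-dimensional representation is a unital algebra homomorphism into the complex
  \<open>n \<times> n\<close> matrices, that is, an action on column vectors after a choice of a basis.
  The degree \<open>n = 0\<close> is allowed, but an irreducible representation is nonzero.
\<close>

definition matrix_rep ::
  "(complex \<Rightarrow> 'a::ring_1 \<Rightarrow> 'a) \<Rightarrow> nat \<Rightarrow> ('a \<Rightarrow> complex mat) \<Rightarrow> bool" where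
  "matrix_rep scale n \<rho> \<longleftrightarrow>
     (\<forall>x. \<rho> x \<in> carrier_mat n n) \<and>
     (\<forall>x y. \<rho> (x + y) = \<rho> x + \<rho> y) \<and>
     (\<forall>c x. \<rho> (scale c x) = c \<cdot>\<^sub>m \<rho> x) \<and>
     (\<forall>x y. \<rho> (x * y) = \<rho> x * \<rho> y) \<and>
     \<rho> 1 = 1\<^sub>m n"

definition irreducible_rep :: "nat \<Rightarrow> ('a \<Rightarrow> complex mat) \<Rightarrow> bool" where
  "irreducible_rep n \<rho> \<longleftrightarrow>
     n > 0 \<and>
     (\<forall>W. VectorSpace.subspace class_ring W (module_vec TYPE(complex) n) \<and>
          (\<forall>x. \<forall>w\<in>W. \<rho> x *\<^sub>v w \<in> W) \<longrightarrow>
          W = {0\<^sub>v n} \<or> W = carrier_vec n)"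

definition mat_trace :: "complex mat \<Rightarrow> complex" where
  "mat_trace M = (\<Sum>i<dim_row M. M $$ (i, i))"

definition is_character ::
  "(complex \<Rightarrow> 'a::ring_1 \<Rightarrow> 'a) \<Rightarrow> ('a \<Rightarrow> complex) \<Rightarrow> bool" where
  "is_character scale \<chi> \<longleftrightarrow>
     (\<exists>n \<rho>. matrix_rep scale n \<rho> \<and> \<chi> = (\<lambda>x. mat_trace (\<rho> x)))"

definition is_irreducible_character ::
  "(complex \<Rightarrow> 'a::ring_1 \<Rightarrow> 'a) \<Rightarrow> ('a \<Rightarrow> complex) \<Rightarrow> bool" where
  "is_irreducible_character scale \<chi> \<longleftrightarrow>
     (\<exists>n \<rho>. matrix_rep scale n \<rho> \<and> irreducible_rep n \<rho> \<and> \<chi> = (\<lambda>x. mat_trace (\<rho> x)))"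

definition char_prod ::
  "(complex \<Rightarrow> 'a::ring_1 \<Rightarrow> 'a) \<Rightarrow> 'a set \<Rightarrow> ('a \<Rightarrow> real) \<Rightarrow>
   ('a \<Rightarrow> complex) \<Rightarrow> ('a \<Rightarrow> complex) \<Rightarrow> 'a \<Rightarrow> complex" where
  "char_prod scale B deg \<chi> \<psi> x =
     (\<Sum>b\<in>B. coord scale B x b * (1 / complex_of_real (deg b) * \<chi> b * \<psi> b))"

end

theory Submission
  imports Defs
begin

text \<open>
  Let $\rho$ be an irreducible representation with character $\chi$, let $\sigma$ be a
  representation with character $\psi$, and put $U(b) = |b|^{-1}\rho(b)$ for $b \in B$.  The
  number $\chi\psi(b)$ is the trace of the Kronecker product $U(b) \otimes \sigma(b)$, so it
  suffices that the linear extension of $b \mapsto U(b) \otimes \sigma(b)$ is multiplicative.  It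
  is, provided that $U(c) = U(a)U(b)$ whenever $c$ occurs in $ab$: the operator $U(a)U(b)$ can then
  be pulled out of the expansion of $ab$ (\<open>matrix_rep_twisted_kronecker\<close>).  In other words,
  $\rho$ has to come from the group that $B$ becomes modulo the strongly normal subset $C$.

  This follows once $\rho(e) = 1$.  Then elements of the span of $C$ act by their degree, since
  $xe = |x|e$ for them (\<open>span_mult_idem\<close>).  Strong normality puts $b^*b$ and $c^*ab$ into that
  span, for $c$ occurring in $ab$ (\<open>triple_in_span\<close>), so that $U(c^*)U(c) = 1$ and
  $U(c^*)U(a)U(b) = 1$ (\<open>rep_mult_proportional\<close>).

  To see $\rho(e) = 1$, it is enough that the image of $\rho(e)$ is an invariant subspace: it is
  nonzero as $\chi(e) \neq 0$, and $\rho$ is irreducible (\<open>irreducible_rep_idem\<close>).  Invariance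
  means $exe = xe$ (\<open>idem_absorbs\<close>) and rests on the fact that $|a|^{-1}ae = |b|^{-1}be$ for
  basis elements with $a^*b$ in the span of $C$ (\<open>same_coset_mult_idem\<close>).  The latter is a
  positivity argument: the difference $y$ of the two sides satisfies $y^*y = 0$, and the
  coefficient of $1$ in $y^*y$ is $\sum_b |y_b|^2|b|$.
\<close>

section \<open>Coordinates, the involution and the canonical trace\<close>

context table_algebra
begin

lemma coord_add: "coord scale B (x + y) b = coord scale B x b + coord scale B y b"
  by (simp add: representation_add[OF independent_Basis] span_Basis)

lemma coord_scale: "coord scale B (scale k x) b = k * coord scale B x b"
  using representation_scale[OF independent_Basis, of x k] by (simp add: span_Basis)

lemma coord_sum: "coord scale B (\<Sum>i\<in>I. f i) b = (\<Sum>i\<in>I. coord scale B (f i) b)"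
  using representation_sum[OF independent_Basis, of I f] by (simp add: span_Basis)

lemma coord_basis: "b \<in> B \<Longrightarrow> coord scale B b c = (if c = b then 1 else 0)"
  using representation_basis[OF independent_Basis, of b] by simp

lemma coord_expand: "(\<Sum>b\<in>B. scale (coord scale B x b) b) = x"
  by (rule sum_representation_eq[OF independent_Basis]) (simp_all add: span_Basis finite_Basis)

lemma coord_eqI:
  assumes "\<And>b. b \<in> B \<Longrightarrow> coord scale B x b = coord scale B y b"
  shows "x = y"
proof -
  have "(\<Sum>b\<in>B. scale (coord scale B x b) b) = (\<Sum>b\<in>B. scale (coord scale B y b) b)"
    using assms by (intro sum.cong) auto
  then show ?thesis by (simp only: coord_expand)
qed

lemma coord_mult:
  "coord scale B (x * y) d = (\<Sum>b\<in>B. \<Sum>c\<in>B. coord scale B x b * coord scale B y c * coord scale B (b * c) d)"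
proof -
  have "x * y = (\<Sum>b\<in>B. scale (coord scale B x b) b) * (\<Sum>c\<in>B. scale (coord scale B y c) c)"
    by (simp only: coord_expand)
  also have "\<dots> = (\<Sum>b\<in>B. \<Sum>c\<in>B. scale (coord scale B x b) (scale (coord scale B y c) (b * c)))"
    by (simp add: sum_product scale_mult_left scale_mult_right mult.commute)
  finally show ?thesis
    by (simp only: coord_sum coord_scale mult.assoc)
qed

lemma mem_span_iff_supp:
  assumes "C \<subseteq> B"
  shows "x \<in> span C \<longleftrightarrow> supp scale B x \<subseteq> C"
proof
  assume "x \<in> span C"
  then have "coord scale B x = coord scale C x"
    using representation_extend[OF independent_Basis _ assms] by blast
  then show "supp scale B x \<subseteq> C"
    by (auto simp: supp_def dest: representation_ne_zero)
next
  assume sub: "supp scale B x \<subseteq> C"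
  have "scale (coord scale B x b) b \<in> span C" if "b \<in> B" for b
  proof (cases "coord scale B x b = 0")
    case False
    then have "b \<in> C" using sub that by (auto simp: supp_def)
    then show ?thesis by (intro span_scale span_base)
  qed (simp add: span_zero)
  then have "(\<Sum>b\<in>B. scale (coord scale B x b) b) \<in> span C"
    by (rule span_sum)
  then show "x \<in> span C" by (simp only: coord_expand)
qed

lemma coord_span_expand:
  assumes "C \<subseteq> B" "x \<in> span C"
  shows "(\<Sum>c\<in>C. scale (coord scale B x c) c) = x"
proof -
  have "(\<Sum>c\<in>C. scale (coord scale B x c) c) = (\<Sum>c\<in>B. scale (coord scale B x c) c)"
    using assms mem_span_iff_supp[OF assms(1), of x]
    by (intro sum.mono_neutral_left finite_Basis) (auto simp: supp_def)
  then show ?thesis by (simp only: coord_expand)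
qed

lemma star_zero: "star 0 = 0"
  using star_add[of 0 0] by simp

lemma star_diff: "star (x - y) = star x - star y"
  using star_add[of "x - y" y] by (simp add: algebra_simps)

lemma star_sum: "star (\<Sum>i\<in>I. f i) = (\<Sum>i\<in>I. star (f i))"
  by (induction I rule: infinite_finite_induct) (simp_all add: star_zero star_add)

lemma star_in_B: "b \<in> B \<Longrightarrow> star b \<in> B"
  using star_B by blast

lemma inj_star: "inj_on star S"
  by (rule inj_onI) (metis star_star)

lemma coord_star:
  assumes "b \<in> B"
  shows "coord scale B (star x) b = cnj (coord scale B x (star b))"
proof -
  have "star x = (\<Sum>a\<in>B. scale (cnj (coord scale B x a)) (star a))"
    by (subst coord_expand[of x, symmetric]) (simp only: star_sum star_scale)
  then have "coord scale B (star x) b = (\<Sum>a\<in>B. cnj (coord scale B x a) * coord scale B (star a) b)"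
    by (simp only: coord_sum coord_scale)
  also have "\<dots> = (\<Sum>a\<in>B. if a = star b then cnj (coord scale B x a) else 0)"
    by (intro sum.cong) (auto simp: coord_basis star_in_B star_star)
  also have "\<dots> = cnj (coord scale B x (star b))"
    using star_in_B[OF assms] finite_Basis by simp
  finally show ?thesis .
qed

lemma deg_map_scale: "deg_map scale B deg (scale k x) = k * deg_map scale B deg x"
  by (simp add: deg_map_def coord_scale sum_distrib_left mult.assoc)

lemma deg_map_sum: "deg_map scale B deg (\<Sum>i\<in>I. f i) = (\<Sum>i\<in>I. deg_map scale B deg (f i))"
  by (simp add: deg_map_def coord_sum sum_distrib_right sum.swap[of _ B])

lemma deg_map_basis:
  assumes "b \<in> B"
  shows "deg_map scale B deg b = complex_of_real (deg b)"
proof -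
  have "deg_map scale B deg b = (\<Sum>c\<in>B. if c = b then complex_of_real (deg c) else 0)"
    unfolding deg_map_def by (intro sum.cong) (simp_all add: coord_basis assms)
  then show ?thesis using assms finite_Basis by simp
qed

lemma deg_one: "deg 1 = 1"
  using deg_map_basis[OF one_in_B] deg_map_one by simp

lemma deg_ne_0: "b \<in> B \<Longrightarrow> deg b \<noteq> 0"
  using deg_pos[of b] by simp

lemma coord_one_mult_basis:
  assumes "b \<in> B"
  shows "coord scale B (x * b) 1 = coord scale B x (star b) * complex_of_real (deg b)"
    and "coord scale B (b * x) 1 = coord scale B x (star b) * complex_of_real (deg b)"
proof -
  have "coord scale B (x * b) 1
      = (\<Sum>a\<in>B. coord scale B x a * coord scale B (a * b) 1)"
    by (subst coord_expand[of x, symmetric])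
       (simp only: sum_distrib_right scale_mult_left coord_sum coord_scale)
  also have "\<dots> = (\<Sum>a\<in>B. if a = star b then coord scale B x a * complex_of_real (deg a) else 0)"
    by (intro sum.cong) (auto simp: coord_one assms)
  finally show "coord scale B (x * b) 1 = coord scale B x (star b) * complex_of_real (deg b)"
    using star_in_B[OF assms] finite_Basis deg_star[OF assms] by simp
  have "coord scale B (b * x) 1
      = (\<Sum>a\<in>B. coord scale B x a * coord scale B (b * a) 1)"
    by (subst coord_expand[of x, symmetric])
       (simp only: sum_distrib_left scale_mult_right coord_sum coord_scale)
  also have "\<dots> = (\<Sum>a\<in>B. if a = star b then coord scale B x a * complex_of_real (deg b) else 0)"
    by (intro sum.cong) (auto simp: coord_one assms star_star)
  finally show "coord scale B (b * x) 1 = coord scale B x (star b) * complex_of_real (deg b)"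
    using star_in_B[OF assms] finite_Basis by simp
qed

text \<open>
  The coordinate at \<open>1\<close> is the canonical trace of the algebra.  It is symmetric because
  $|b| = |b^*|$.  By \<open>coord_one_mult_basis\<close>, its values on products with basis elements
  determine all coordinates, so identities between structure constants can be read off from it.
\<close>

lemma coord_one_commute: "coord scale B (x * y) 1 = coord scale B (y * x) 1"
proof -
  have "coord scale B (x * y) 1 = (\<Sum>b\<in>B. coord scale B y b * coord scale B (x * b) 1)"
    by (subst coord_expand[of y, symmetric])
       (simp only: sum_distrib_left scale_mult_right coord_sum coord_scale)
  also have "\<dots> = (\<Sum>b\<in>B. coord scale B y b * coord scale B (b * x) 1)"
    by (intro sum.cong) (simp_all add: coord_one_mult_basis)
  also have "\<dots> = coord scale B (y * x) 1"
    by (subst (2) coord_expand[of y, symmetric])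
       (simp only: sum_distrib_right scale_mult_left coord_sum coord_scale)
  finally show ?thesis .
qed

lemma coord_one_star_mult:
  "coord scale B (star y * y) 1 = complex_of_real (\<Sum>b\<in>B. (cmod (coord scale B y b))\<^sup>2 * deg b)"
proof -
  have star_y: "star y = (\<Sum>b\<in>B. scale (cnj (coord scale B y b)) (star b))"
    by (subst coord_expand[of y, symmetric]) (simp only: star_sum star_scale)
  have "coord scale B (star y * y) 1
      = coord scale B (y * (\<Sum>b\<in>B. scale (cnj (coord scale B y b)) (star b))) 1"
    unfolding star_y[symmetric] by (rule coord_one_commute)
  also have "\<dots> = (\<Sum>b\<in>B. cnj (coord scale B y b) * coord scale B (y * star b) 1)"
    by (simp only: sum_distrib_left scale_mult_right coord_sum coord_scale)
  also have "\<dots> = (\<Sum>b\<in>B. complex_of_real ((cmod (coord scale B y b))\<^sup>2 * deg b))"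
    by (intro sum.cong)
       (simp_all only: coord_one_mult_basis star_in_B star_star deg_star complex_norm_square
          of_real_mult mult_ac)
  finally show ?thesis by (simp only: of_real_sum)
qed

text \<open>
  The form $(x, y) \<mapsto> \tau(x^* y)$ given by the canonical trace $\tau$ is positive definite,
  so it detects equality of two elements from products alone.
\<close>

lemma star_mult_self_eq_0:
  assumes "star y * y = 0"
  shows "y = 0"
proof (rule coord_eqI)
  fix b assume b: "b \<in> B"
  have "(\<Sum>b\<in>B. (cmod (coord scale B y b))\<^sup>2 * deg b) = 0"
    using coord_one_star_mult[of y] assms by (simp add: representation_zero del: of_real_sum)
  moreover have "(cmod (coord scale B y b))\<^sup>2 * deg b \<ge> 0" if "b \<in> B" for b
    using deg_pos[OF that] by simp
  ultimately have "(cmod (coord scale B y b))\<^sup>2 * deg b = 0"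
    using b finite_Basis by (simp add: sum_nonneg_eq_0_iff)
  then show "coord scale B y b = coord scale B 0 b"
    using deg_ne_0[OF b] by (simp add: representation_zero)
qed

section \<open>Supports of products\<close>

definition nonneg_elements :: "'a set" where
  "nonneg_elements = {x. \<forall>b\<in>B. coord scale B x b \<in> \<real>\<^sub>\<ge>\<^sub>0}"

lemma nonneg_basis: "b \<in> B \<Longrightarrow> b \<in> nonneg_elements"
  by (simp add: nonneg_elements_def coord_basis)

lemma nonneg_mult_basis: "a \<in> B \<Longrightarrow> b \<in> B \<Longrightarrow> a * b \<in> nonneg_elements"
  by (simp add: nonneg_elements_def structure_constants_nonneg)

lemma sum_nonneg_Reals:
  assumes "\<And>i. i \<in> S \<Longrightarrow> f i \<in> (\<real>\<^sub>\<ge>\<^sub>0 :: complex set)"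
  shows "sum f S \<in> \<real>\<^sub>\<ge>\<^sub>0"
  using assms by (auto simp: complex_nonneg_Reals_iff intro!: sum_nonneg sum.neutral)

lemma sum_nonneg_Reals_eq_0_iff:
  assumes "finite S" "\<And>i. i \<in> S \<Longrightarrow> f i \<in> (\<real>\<^sub>\<ge>\<^sub>0 :: complex set)"
  shows "sum f S = 0 \<longleftrightarrow> (\<forall>i\<in>S. f i = 0)"
proof
  assume "sum f S = 0"
  then have "(\<Sum>i\<in>S. Re (f i)) = 0" by (simp flip: Re_sum)
  then have "\<forall>i\<in>S. Re (f i) = 0"
    using assms by (subst (asm) sum_nonneg_eq_0_iff) (auto simp: complex_nonneg_Reals_iff)
  then show "\<forall>i\<in>S. f i = 0"
    using assms by (auto simp: complex_nonneg_Reals_iff complex_eq_iff)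
qed simp

text \<open>
  No cancellation can occur in a product of elements with nonnegative coordinates.  Hence
  supports of products are computed setwise, which translates the set conditions on \<open>C\<close> into
  membership in the linear span of \<open>C\<close> and back.
\<close>

lemma supp_mult_nonneg:
  assumes "x \<in> nonneg_elements" "y \<in> nonneg_elements"
  shows "supp scale B (x * y) = cprod scale B (supp scale B x) (supp scale B y)"
proof -
  let ?t = "\<lambda>d b c. coord scale B x b * coord scale B y c * coord scale B (b * c) d"
  have nn: "?t d b c \<in> \<real>\<^sub>\<ge>\<^sub>0" if "d \<in> B" "b \<in> B" "c \<in> B" for b c d
    using assms that by (simp add: nonneg_elements_def structure_constants_nonneg)
  have sum_nn: "(\<Sum>c\<in>B. ?t d b c) \<in> \<real>\<^sub>\<ge>\<^sub>0" if "d \<in> B" "b \<in> B" for b d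
    using nn that by (intro sum_nonneg_Reals)
  have "coord scale B (x * y) d = 0 \<longleftrightarrow> (\<forall>b\<in>B. \<forall>c\<in>B. ?t d b c = 0)" if "d \<in> B" for d
  proof -
    have "coord scale B (x * y) d = 0 \<longleftrightarrow> (\<forall>b\<in>B. (\<Sum>c\<in>B. ?t d b c) = 0)"
      unfolding coord_mult[of x y] using sum_nn that
      by (intro sum_nonneg_Reals_eq_0_iff finite_Basis) auto
    also have "\<dots> \<longleftrightarrow> (\<forall>b\<in>B. \<forall>c\<in>B. ?t d b c = 0)"
      using nn that by (intro ball_cong refl sum_nonneg_Reals_eq_0_iff finite_Basis) auto
    finally show ?thesis .
  qed
  then have "d \<in> supp scale B (x * y) \<longleftrightarrow> d \<in> B \<and> (\<exists>b\<in>B. \<exists>c\<in>B. ?t d b c \<noteq> 0)" for d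
    by (auto simp: supp_def)
  then have "d \<in> supp scale B (x * y) \<longleftrightarrow> d \<in> cprod scale B (supp scale B x) (supp scale B y)" for d
    by (simp add: supp_def cprod_def) blast
  then show ?thesis by blast
qed

lemma nonneg_mult:
  assumes "x \<in> nonneg_elements" "y \<in> nonneg_elements"
  shows "x * y \<in> nonneg_elements"
proof -
  have "coord scale B (x * y) d \<in> \<real>\<^sub>\<ge>\<^sub>0" if "d \<in> B" for d
    unfolding coord_mult[of x y] using assms that
    by (intro sum_nonneg_Reals nonneg_Reals_mult_I structure_constants_nonneg)
       (auto simp: nonneg_elements_def)
  then show ?thesis by (simp add: nonneg_elements_def)
qed

lemma nonneg_star: "x \<in> nonneg_elements \<Longrightarrow> star x \<in> nonneg_elements"
  by (auto simp: nonneg_elements_def coord_star star_in_B complex_nonneg_Reals_iff)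

lemma supp_basis: "b \<in> B \<Longrightarrow> supp scale B b = {b}"
  by (auto simp: supp_def coord_basis)

lemma supp_star: "supp scale B (star x) = star ` supp scale B x"
proof -
  have sub: "star ` supp scale B y \<subseteq> supp scale B (star y)" for y
    by (auto simp: supp_def coord_star star_in_B star_star)
  have "supp scale B (star x) = star ` star ` supp scale B (star x)"
    by (simp add: image_image star_star)
  also have "\<dots> \<subseteq> star ` supp scale B (star (star x))"
    by (intro image_mono sub)
  finally show ?thesis using sub[of x] by (auto simp: star_star)
qed

lemma cprod_mono: "E \<subseteq> E' \<Longrightarrow> D \<subseteq> D' \<Longrightarrow> cprod scale B E D \<subseteq> cprod scale B E' D'"
  by (auto simp: cprod_def)

end

section \<open>The idempotent of a closed subset\<close>

locale table_algebra_closed = table_algebra +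
  fixes C
  assumes closed: "closed_subset scale B star C"
begin

lemma closed_sub: "C \<subseteq> B"
  using closed by (simp add: closed_subset_def)

lemma finite_closed: "finite C"
  using closed_sub finite_Basis by (rule finite_subset)

lemma star_mult_in_span: "c \<in> C \<Longrightarrow> d \<in> C \<Longrightarrow> star c * d \<in> span C"
  using closed by (fastforce simp: mem_span_iff_supp[OF closed_sub] closed_subset_def cprod_def)

lemma one_in_closed: "1 \<in> C"
proof -
  obtain c where c: "c \<in> C" using closed by (auto simp: closed_subset_def)
  then have cB: "c \<in> B" using closed_sub by blast
  have "coord scale B (star c * c) 1 \<noteq> 0"
    using coord_one[OF star_in_B[OF cB] cB] deg_ne_0[OF cB] by (simp add: deg_star cB)
  then show ?thesis
    using star_mult_in_span[OF c c] one_in_B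
    by (auto simp: mem_span_iff_supp[OF closed_sub] supp_def)
qed

lemma star_in_closed:
  assumes "c \<in> C"
  shows "star c \<in> C"
proof -
  have "star c \<in> B" using assms closed_sub star_in_B by blast
  moreover have "star c \<in> span C" using star_mult_in_span[OF assms one_in_closed] by simp
  ultimately show ?thesis
    by (simp add: mem_span_iff_supp[OF closed_sub] supp_basis)
qed

lemma star_image_closed: "star ` C = C"
proof
  show "star ` C \<subseteq> C" using star_in_closed by blast
  then have "star ` star ` C \<subseteq> star ` C" by (rule image_mono)
  then show "C \<subseteq> star ` C" by (simp add: image_image star_star)
qed

lemma mult_in_span: "c \<in> C \<Longrightarrow> d \<in> C \<Longrightarrow> c * d \<in> span C"
  using star_mult_in_span[OF star_in_closed] by (simp add: star_star)

lemma star_in_span: "x \<in> span C \<Longrightarrow> star x \<in> span C"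
  using star_image_closed by (auto simp: mem_span_iff_supp[OF closed_sub] supp_star)

abbreviation C_sum :: 'a where
  "C_sum \<equiv> \<Sum>C"

lemma coord_C_sum: "coord scale B C_sum b = (if b \<in> C then 1 else 0)"
proof -
  have "coord scale B C_sum b = (\<Sum>c\<in>C. if c = b then 1 else 0)"
    unfolding coord_sum using closed_sub by (intro sum.cong) (auto simp: coord_basis)
  then show ?thesis using finite_closed by simp
qed

lemma star_C_sum: "star C_sum = C_sum"
  using sum.reindex[OF inj_star[of C], of "\<lambda>x. x"]
  unfolding star_sum star_image_closed o_def by (rule sym)

text \<open>
  The coordinate of $c\,C^+$ at $f \in C$ is, up to the factor $|f|$, the trace of $c\,C^+ f^*$.
  Moving $f^*$ to the front turns this into the trace of $(f^* c)\,C^+$.  Since $f^* c$ is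
  supported in \<open>C\<close>, the latter is the degree $|f^* c| = |f|\,|c|$.
\<close>

lemma mult_C_sum:
  assumes c: "c \<in> C"
  shows "c * C_sum = scale (complex_of_real (deg c)) C_sum"
proof (rule coord_eqI)
  fix f assume f: "f \<in> B"
  have cB: "c \<in> B" using c closed_sub by blast
  show "coord scale B (c * C_sum) f = coord scale B (scale (complex_of_real (deg c)) C_sum) f"
  proof (cases "f \<in> C")
    case False
    have "c * C_sum \<in> span C"
      unfolding sum_distrib_left using mult_in_span[OF c] by (rule span_sum)
    then have "coord scale B (c * C_sum) f = 0"
      using False f by (auto simp: mem_span_iff_supp[OF closed_sub] supp_def)
    then show ?thesis using False by (simp add: coord_scale coord_C_sum)
  next
    case True
    let ?y = "star f * c"
    have y: "?y \<in> span C" using star_mult_in_span True c .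
    have "coord scale B (c * C_sum) f * complex_of_real (deg f) = coord scale B (c * C_sum * star f) 1"
      using f by (simp add: coord_one_mult_basis star_in_B star_star deg_star)
    also have "\<dots> = coord scale B (?y * C_sum) 1"
      using coord_one_commute[of "c * C_sum" "star f"] by (simp add: mult.assoc)
    also have "\<dots> = (\<Sum>d\<in>C. coord scale B (?y * d) 1)"
      by (simp only: sum_distrib_left coord_sum)
    also have "\<dots> = (\<Sum>d\<in>C. coord scale B ?y (star d) * complex_of_real (deg (star d)))"
      using closed_sub by (intro sum.cong) (auto simp: coord_one_mult_basis deg_star)
    also have "\<dots> = (\<Sum>d\<in>C. coord scale B ?y d * complex_of_real (deg d))"
      using sum.reindex[OF inj_star[of C], of "\<lambda>d. coord scale B ?y d * complex_of_real (deg d)"]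
      by (simp add: star_image_closed)
    also have "\<dots> = deg_map scale B deg (\<Sum>d\<in>C. scale (coord scale B ?y d) d)"
      unfolding deg_map_sum using closed_sub
      by (intro sum.cong) (auto simp: deg_map_scale deg_map_basis)
    also have "\<dots> = complex_of_real (deg f) * complex_of_real (deg c)"
      unfolding coord_span_expand[OF closed_sub y]
      by (simp add: deg_map_mult deg_map_basis star_in_B f cB deg_star)
    finally have "coord scale B (c * C_sum) f = complex_of_real (deg c)"
      using deg_ne_0[OF f] by simp
    then show ?thesis using True by (simp add: coord_scale coord_C_sum)
  qed
qed

abbreviation e :: 'a where
  "e \<equiv> closed_idem scale B deg C"

lemma deg_map_C_sum: "deg_map scale B deg C_sum = complex_of_real (\<Sum>c\<in>C. deg c)"
  unfolding deg_map_sum of_real_sum using closed_sub by (intro sum.cong) (auto simp: deg_map_basis)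

lemma deg_C_sum_pos: "(\<Sum>c\<in>C. deg c) > 0"
  using closed_sub deg_pos closed finite_closed
  by (intro sum_pos) (auto simp: closed_subset_def)

lemma star_idem: "star e = e"
  by (simp add: closed_idem_def star_scale star_C_sum deg_map_C_sum)

lemma deg_map_idem: "deg_map scale B deg e = 1"
  using deg_C_sum_pos by (simp add: closed_idem_def deg_map_scale deg_map_C_sum del: of_real_sum)

lemma idem_in_span: "e \<in> span C"
  unfolding closed_idem_def by (intro span_scale span_sum span_base)

lemma span_mult_idem:
  assumes "x \<in> span C"
  shows "x * e = scale (deg_map scale B deg x) e"
proof -
  have "c * e = scale (deg_map scale B deg c) e" if "c \<in> C" for c
    using that closed_sub mult_C_sum[OF that]
    by (auto simp: closed_idem_def scale_mult_right deg_map_basis scale_left_commute)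
  then have "(\<Sum>c\<in>C. scale (coord scale B x c) c) * e
      = (\<Sum>c\<in>C. scale (coord scale B x c * deg_map scale B deg c) e)"
    by (simp add: sum_distrib_right scale_mult_left)
  also have "\<dots> = scale (deg_map scale B deg (\<Sum>c\<in>C. scale (coord scale B x c) c)) e"
    by (simp only: deg_map_sum deg_map_scale scale_sum_left)
  finally show ?thesis by (simp only: coord_span_expand[OF closed_sub assms])
qed

lemma idem_idem: "e * e = e"
  using span_mult_idem[OF idem_in_span] by (simp add: deg_map_idem)

text \<open>
  With $p = |a|^{-1}a$ and $q = |b|^{-1}b$ all four products $p^*p$, $p^*q$, $q^*p$, $q^*q$ lie in
  the span of \<open>C\<close> and have degree 1, so they act on $e$ as the identity.  Expanding
  $(pe - qe)^*(pe - qe)$ gives $e - e - e + e = 0$, and definiteness of the trace form gives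
  $pe = qe$.
\<close>

lemma same_coset_mult_idem:
  assumes a: "a \<in> B" and b: "b \<in> B"
    and "star a * a \<in> span C" "star b * b \<in> span C" "star a * b \<in> span C"
  shows "scale (complex_of_real (inverse (deg a))) a * e = scale (complex_of_real (inverse (deg b))) b * e"
proof -
  let ?a = "scale (complex_of_real (inverse (deg a))) a"
  let ?b = "scale (complex_of_real (inverse (deg b))) b"
  have ba: "star b * a \<in> span C"
    using star_in_span[OF assms(5)] by (simp add: star_mult star_star)
  have span: "star p * q \<in> span C" if "p \<in> {?a, ?b}" "q \<in> {?a, ?b}" for p q
    using that assms(3-5) ba
    by (auto simp del: of_real_inverse simp: star_scale scale_mult_left scale_mult_right intro!: span_scale)
  have deg: "deg_map scale B deg p = 1 \<and> deg_map scale B deg (star p) = 1" if "p \<in> {?a, ?b}" for p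
    using that a b deg_ne_0
    by (auto simp: star_scale deg_map_scale deg_map_basis star_in_B deg_star)
  have eq: "(star p * q) * e = e" if "p \<in> {?a, ?b}" "q \<in> {?a, ?b}" for p q
    using span_mult_idem[OF span[OF that]] deg that by (simp only: deg_map_mult) simp
  have "star (?a * e - ?b * e) * (?a * e - ?b * e)
     = e * (star ?a * ?a * e) - e * (star ?a * ?b * e) - (e * (star ?b * ?a * e) - e * (star ?b * ?b * e))"
    by (simp only: star_diff star_mult star_idem algebra_simps)
  also have "\<dots> = 0" by (simp only: eq insert_iff simp_thms) simp
  finally have "?a * e - ?b * e = 0" by (rule star_mult_self_eq_0)
  then show ?thesis by simp
qed

end

section \<open>Strongly normal closed subsets\<close>

locale table_algebra_strongly_normal = table_algebra_closed +
  assumes strongly_normal: "strongly_normal scale B star C"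
begin

lemma conjugate_in_span:
  assumes b: "b \<in> B" and x: "x \<in> span C"
  shows "star b * x * b \<in> span C"
proof -
  have "star b * c * b \<in> span C" if c: "c \<in> C" for c
  proof -
    have cB: "c \<in> B" using c closed_sub by blast
    have "supp scale B (star b * c * b) = cprod scale B (cprod scale B {star b} {c}) {b}"
      using b cB
      by (simp add: supp_mult_nonneg nonneg_mult nonneg_basis star_in_B supp_basis)
    also have "\<dots> \<subseteq> cprod scale B (cprod scale B {star b} C) {b}"
      using c by (intro cprod_mono) auto
    also have "\<dots> \<subseteq> C" using strongly_normal b by (simp add: strongly_normal_def)
    finally show ?thesis by (simp add: mem_span_iff_supp[OF closed_sub])
  qed
  then have "(\<Sum>c\<in>C. scale (coord scale B x c) (star b * c * b)) \<in> span C"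
    by (intro span_sum span_scale)
  also have "(\<Sum>c\<in>C. scale (coord scale B x c) (star b * c * b))
      = star b * (\<Sum>c\<in>C. scale (coord scale B x c) c) * b"
    by (simp only: sum_distrib_left sum_distrib_right scale_mult_left scale_mult_right)
  finally show ?thesis by (simp only: coord_span_expand[OF closed_sub x])
qed

lemma star_mult_self_in_span: "b \<in> B \<Longrightarrow> star b * b \<in> span C"
  using conjugate_in_span[of b 1] one_in_closed by (simp add: span_base)

text \<open>
  A set condition known for a whole product $zu$ is inherited by the single basis elements that
  occur in $u$, because nothing cancels.
\<close>

lemma mult_supp_in_span:
  assumes "z * u \<in> span C" "z \<in> nonneg_elements" "u \<in> nonneg_elements" "x \<in> supp scale B u"
  shows "z * x \<in> span C"
proof -
  have x: "x \<in> B" using assms(4) by (simp add: supp_def)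
  have "supp scale B (z * x) \<subseteq> supp scale B (z * u)"
    using assms(2-4) x
    by (simp add: supp_mult_nonneg nonneg_basis supp_basis cprod_mono)
  then show ?thesis using assms(1) by (auto simp: mem_span_iff_supp[OF closed_sub])
qed

text \<open>
  For $x$ in the support of $cb$, the product $b^*x$ is supported in $b^*Cb \subseteq C$.  So $x$
  and $b$ lie in the same coset, and $xe$ is the multiple $|x|\,|b|^{-1}$ of $be$.  Summing over the support of $cb$
  produces the total degree $|cb| = |c|\,|b|$.
\<close>

lemma closed_mult_basis_idem:
  assumes c: "c \<in> C" and b: "b \<in> B"
  shows "c * b * e = scale (complex_of_real (deg c)) (b * e)"
proof -
  have cB: "c \<in> B" using c closed_sub by blast
  let ?r = "coord scale B (c * b)"
  let ?k = "complex_of_real (inverse (deg b))"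
  have x: "scale (?r x) (x * e) = scale (?r x * complex_of_real (deg x)) (scale ?k (b * e))" if "x \<in> B" for x
  proof (cases "?r x = 0")
    case False
    then have "x \<in> supp scale B (c * b)" using that by (simp add: supp_def)
    then have "star b * x \<in> span C"
      using conjugate_in_span[OF b span_base[OF c]] b cB
      by - (rule mult_supp_in_span[of _ "c * b"],
           simp_all add: mult.assoc nonneg_basis star_in_B nonneg_mult_basis)
    then have "scale ?k b * e = scale (complex_of_real (inverse (deg x))) x * e"
      using star_mult_self_in_span that b by (intro same_coset_mult_idem)
    then show ?thesis using deg_ne_0[OF that] by (simp add: scale_mult_left)
  qed simp
  have "c * b * e = (\<Sum>x\<in>B. scale (?r x) x) * e" by (simp only: coord_expand)
  also have "\<dots> = (\<Sum>x\<in>B. scale (?r x * complex_of_real (deg x)) (scale ?k (b * e)))"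
    by (simp add: sum_distrib_right scale_mult_left x)
  also have "\<dots> = scale (deg_map scale B deg (c * b)) (scale ?k (b * e))"
    by (simp only: deg_map_def scale_sum_left)
  also have "\<dots> = scale (complex_of_real (deg c)) (b * e)"
    using b cB deg_ne_0[OF b] by (simp add: deg_map_mult deg_map_basis)
  finally show ?thesis .
qed

text \<open>
  One half of the centrality of $e$.  It makes the image of $e$ invariant in every
  representation.
\<close>

lemma idem_absorbs: "e * x * e = x * e"
proof -
  have basis: "e * b * e = b * e" if b: "b \<in> B" for b
  proof -
    let ?r = "coord scale B e"
    have "e * b * e = (\<Sum>c\<in>C. scale (?r c) c) * b * e"
      by (simp only: coord_span_expand[OF closed_sub idem_in_span])
    also have "\<dots> = (\<Sum>c\<in>C. scale (?r c * deg_map scale B deg c) (b * e))"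
      using closed_sub closed_mult_basis_idem b
      by (auto simp: sum_distrib_right scale_mult_left deg_map_basis intro!: sum.cong)
    also have "\<dots> = scale (deg_map scale B deg (\<Sum>c\<in>C. scale (?r c) c)) (b * e)"
      by (simp only: deg_map_sum deg_map_scale scale_sum_left)
    finally show ?thesis
      by (simp only: coord_span_expand[OF closed_sub idem_in_span] deg_map_idem scale_one)
  qed
  have "e * (\<Sum>b\<in>B. scale (coord scale B x b) b) * e = (\<Sum>b\<in>B. scale (coord scale B x b) b) * e"
    by (simp add: sum_distrib_left sum_distrib_right scale_mult_left scale_mult_right basis)
  then show ?thesis by (simp only: coord_expand)
qed

text \<open>
  Modulo \<open>C\<close> the basis elements multiply like elements of a group: if $c$ occurs in $ab$, then
  $c^*ab$ is supported in \<open>C\<close>.  The reason is that $c^*ab$ is adjoint to $(ab)^*c$, whose support is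
  contained in that of $b^*(a^*a)b$, with $a^*a$ supported in \<open>C\<close>; now $b^*Cb \subseteq C$ applies.
\<close>

lemma triple_in_span:
  assumes a: "a \<in> B" and b: "b \<in> B" and c: "c \<in> supp scale B (a * b)"
  shows "star c * (a * b) \<in> span C"
proof -
  have "star (a * b) * (a * b) = star b * (star a * a) * b"
    by (simp add: star_mult mult.assoc)
  also have "\<dots> \<in> span C"
    by (intro conjugate_in_span b star_mult_self_in_span a)
  finally have "star (a * b) * c \<in> span C"
    by (rule mult_supp_in_span[OF _ nonneg_star[OF nonneg_mult_basis[OF a b]]
          nonneg_mult_basis[OF a b] c])
  then have "star (star (a * b) * c) \<in> span C" by (rule star_in_span)
  then show ?thesis by (simp add: star_mult star_star)
qed

end

section \<open>Kronecker products of matrices\<close>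

text \<open>
  The pair $(i, k)$ of row indices is encoded as $i m + k$, where $m$ is the number of rows of the
  second factor, and similarly for columns; \<open>div\<close> and \<open>mod\<close> decode it.
\<close>

definition kronecker :: "'a::comm_semiring_1 mat \<Rightarrow> 'a mat \<Rightarrow> 'a mat" where
  "kronecker P Q = mat (dim_row P * dim_row Q) (dim_col P * dim_col Q)
     (\<lambda>(i, j). P $$ (i div dim_row Q, j div dim_col Q) * Q $$ (i mod dim_row Q, j mod dim_col Q))"

lemma div_mod_less:
  assumes "k < n * (m::nat)"
  shows "k div m < n" "k mod m < m"
  using assms by (simp_all add: less_mult_imp_div_less) (cases m; simp)

lemma sum_div_mod:
  fixes f :: "nat \<Rightarrow> nat \<Rightarrow> 'a::comm_monoid_add"
  shows "(\<Sum>k<n * m. f (k div m) (k mod m)) = (\<Sum>i<n. \<Sum>j<m. f i j)"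
proof -
  have "(\<Sum>k<n * m. f (k div m) (k mod m)) = (\<Sum>(i, j)\<in>{..<n} \<times> {..<m}. f i j)"
  proof (rule sum.reindex_bij_witness[where i = "\<lambda>(i, j). i * m + j" and j = "\<lambda>k. (k div m, k mod m)"])
    fix p assume "p \<in> {..<n} \<times> {..<m}"
    then obtain i j where p: "p = (i, j)" "i < n" "j < m" by auto
    have "i * m + j < i * m + m" using p by simp
    also have "\<dots> \<le> n * m" using p mult_le_mono1[of "Suc i" n m] by simp
    finally show "(case p of (i, j) \<Rightarrow> i * m + j) \<in> {..<n * m}" using p by simp
  qed (auto simp: div_mod_less)
  then show ?thesis by (simp add: sum.cartesian_product)
qed

lemma kronecker_carrier:
  "P \<in> carrier_mat n n' \<Longrightarrow> Q \<in> carrier_mat m m' \<Longrightarrow> kronecker P Q \<in> carrier_mat (n * m) (n' * m')"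
  by (simp add: kronecker_def)

lemma kronecker_index:
  assumes "P \<in> carrier_mat n n'" "Q \<in> carrier_mat m m'" "i < n * m" "j < n' * m'"
  shows "kronecker P Q $$ (i, j) = P $$ (i div m, j div m') * Q $$ (i mod m, j mod m')"
  using assms by (auto simp: kronecker_def)

lemma mat_mult_index:
  assumes "P \<in> carrier_mat n l" "Q \<in> carrier_mat l m" "i < n" "j < m"
  shows "(P * Q) $$ (i, j) = (\<Sum>k<l. P $$ (i, k) * Q $$ (k, j))"
  using assms by (auto simp: scalar_prod_def atLeast0LessThan intro!: sum.cong)

lemma kronecker_mult:
  fixes P P' Q Q' :: "'a::comm_ring_1 mat"
  assumes P: "P \<in> carrier_mat n n'" and P': "P' \<in> carrier_mat n' n''"
    and Q: "Q \<in> carrier_mat m m'" and Q': "Q' \<in> carrier_mat m' m''"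
  shows "kronecker P Q * kronecker P' Q' = kronecker (P * P') (Q * Q')"
proof (rule eq_matI)
  have PP: "P * P' \<in> carrier_mat n n''" and QQ: "Q * Q' \<in> carrier_mat m m''"
    using assms by auto
  fix i j assume "i < dim_row (kronecker (P * P') (Q * Q'))" "j < dim_col (kronecker (P * P') (Q * Q'))"
  then have ij: "i < n * m" "j < n'' * m''"
    using kronecker_carrier[OF PP QQ] by auto
  have "(kronecker P Q * kronecker P' Q') $$ (i, j)
      = (\<Sum>k<n' * m'. kronecker P Q $$ (i, k) * kronecker P' Q' $$ (k, j))"
    by (rule mat_mult_index[OF kronecker_carrier[OF P Q] kronecker_carrier[OF P' Q'] ij])
  also have "\<dots> = (\<Sum>k<n' * m'. P $$ (i div m, k div m') * Q $$ (i mod m, k mod m')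
      * (P' $$ (k div m', j div m'') * Q' $$ (k mod m', j mod m'')))"
    by (intro sum.cong) (simp_all add: kronecker_index[OF P Q] kronecker_index[OF P' Q'] ij)
  also have "\<dots> = (\<Sum>k<n'. P $$ (i div m, k) * P' $$ (k, j div m''))
      * (\<Sum>l<m'. Q $$ (i mod m, l) * Q' $$ (l, j mod m''))"
    unfolding sum_product
    by (subst sum_div_mod[of "\<lambda>k l. P $$ (i div m, k) * Q $$ (i mod m, l)
      * (P' $$ (k, j div m'') * Q' $$ (l, j mod m''))"]) (simp only: mult_ac)
  also have "\<dots> = kronecker (P * P') (Q * Q') $$ (i, j)"
    by (simp only: kronecker_index[OF PP QQ ij] mat_mult_index[OF P P' div_mod_less(1)[OF ij(1)] div_mod_less(1)[OF ij(2)]]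
       mat_mult_index[OF Q Q' div_mod_less(2)[OF ij(1)] div_mod_less(2)[OF ij(2)]])
  finally show "(kronecker P Q * kronecker P' Q') $$ (i, j) = kronecker (P * P') (Q * Q') $$ (i, j)" .
qed (use assms in \<open>auto simp: kronecker_def\<close>)

lemma kronecker_one: "kronecker (1\<^sub>m n) (1\<^sub>m m) = (1\<^sub>m (n * m) :: 'a::comm_semiring_1 mat)"
proof (rule eq_matI)
  fix i j assume ij: "i < dim_row (1\<^sub>m (n * m) :: 'a mat)" "j < dim_col (1\<^sub>m (n * m) :: 'a mat)"
  have "i = j \<longleftrightarrow> i div m = j div m \<and> i mod m = j mod m"
    by (metis div_mult_mod_eq)
  then show "kronecker (1\<^sub>m n) (1\<^sub>m m) $$ (i, j) = (1\<^sub>m (n * m) :: 'a mat) $$ (i, j)"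
    using ij by (auto simp: kronecker_def div_mod_less)
qed (simp_all add: kronecker_def)

lemma kronecker_trace:
  assumes P: "P \<in> carrier_mat n n" and Q: "Q \<in> carrier_mat m m"
  shows "mat_trace (kronecker P Q) = mat_trace P * mat_trace Q"
proof -
  have "mat_trace (kronecker P Q) = (\<Sum>k<n * m. P $$ (k div m, k div m) * Q $$ (k mod m, k mod m))"
    using kronecker_carrier[OF P Q]
    by (auto simp: mat_trace_def kronecker_index[OF P Q] intro!: sum.cong)
  also have "\<dots> = mat_trace P * mat_trace Q"
    using P Q by (simp add: sum_div_mod[of "\<lambda>k l. P $$ (k, k) * Q $$ (l, l)"] mat_trace_def sum_product)
  finally show ?thesis .
qed

lemma mat_eq_by_vectors:
  fixes P Q :: "'a::comm_ring_1 mat"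
  assumes P: "P \<in> carrier_mat n m" and Q: "Q \<in> carrier_mat n m"
    and eq: "\<And>v. v \<in> carrier_vec m \<Longrightarrow> P *\<^sub>v v = Q *\<^sub>v v"
  shows "P = Q"
proof (rule eq_matI)
  fix i j assume ij: "i < dim_row Q" "j < dim_col Q"
  have "P $$ (i, j) = (P *\<^sub>v unit_vec m j) $ i" using P Q ij by simp
  also have "\<dots> = Q $$ (i, j)" unfolding eq[OF unit_vec_carrier] using Q ij by simp
  finally show "P $$ (i, j) = Q $$ (i, j)" .
qed (use P Q in auto)

section \<open>Matrix representations\<close>

context table_algebra
begin

lemma matrix_repD:
  assumes "matrix_rep scale n \<rho>"
  shows "\<rho> x \<in> carrier_mat n n" "\<rho> (x + y) = \<rho> x + \<rho> y" "\<rho> (scale k x) = k \<cdot>\<^sub>m \<rho> x"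
    "\<rho> (x * y) = \<rho> x * \<rho> y" "\<rho> 1 = 1\<^sub>m n"
  using assms by (auto simp: matrix_rep_def)

lemma matrix_rep_index:
  assumes rep: "matrix_rep scale n \<rho>" and ij: "i < n" "j < n"
  shows "\<rho> x $$ (i, j) = (\<Sum>b\<in>B. coord scale B x b * \<rho> b $$ (i, j))"
proof -
  note rep_simps = matrix_repD[OF rep]
  have dim: "dim_row (\<rho> y) = n" "dim_col (\<rho> y) = n" for y
    using rep_simps(1)[of y] by auto
  have zero: "\<rho> 0 $$ (i, j) = 0"
    using rep_simps(3)[of 0 0] ij by (metis dim index_smult_mat(1) mult_zero_left scale_zero_left)
  have "\<rho> (\<Sum>b\<in>S. scale (f b) b) $$ (i, j) = (\<Sum>b\<in>S. f b * \<rho> b $$ (i, j))" for S f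
    by (induction S rule: infinite_finite_induct) (simp_all add: zero rep_simps(2,3) dim ij)
  from this[of "coord scale B x" B] show ?thesis by (simp only: coord_expand)
qed

definition linear_ext :: "nat \<Rightarrow> ('a \<Rightarrow> complex mat) \<Rightarrow> 'a \<Rightarrow> complex mat" where
  "linear_ext n M x = mat n n (\<lambda>ij. \<Sum>b\<in>B. coord scale B x b * M b $$ ij)"

lemma linear_ext_basis:
  assumes "b \<in> B" "M b \<in> carrier_mat n n"
  shows "linear_ext n M b = M b"
proof (rule eq_matI)
  fix i j assume ij: "i < dim_row (M b)" "j < dim_col (M b)"
  have "(\<Sum>c\<in>B. coord scale B b c * M c $$ (i, j)) = (\<Sum>c\<in>B. if c = b then M c $$ (i, j) else 0)"
    using assms by (intro sum.cong) (auto simp: coord_basis)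
  then show "linear_ext n M b $$ (i, j) = M b $$ (i, j)"
    using assms ij finite_Basis by (simp add: linear_ext_def)
qed (use assms in \<open>simp_all add: linear_ext_def\<close>)

text \<open>
  Both sides of $M(xy) = M(x)M(y)$ are bilinear, so multiplicativity has to be checked only on
  pairs of basis elements.
\<close>

lemma matrix_rep_linear_ext:
  assumes M: "\<And>b. b \<in> B \<Longrightarrow> M b \<in> carrier_mat n n"
    and M_one: "M 1 = 1\<^sub>m n"
    and M_mult: "\<And>a b. a \<in> B \<Longrightarrow> b \<in> B \<Longrightarrow> linear_ext n M (a * b) = M a * M b"
  shows "matrix_rep scale n (linear_ext n M)"
proof -
  have carrier: "linear_ext n M x \<in> carrier_mat n n" for x
    by (simp add: linear_ext_def)
  have add: "linear_ext n M (x + y) = linear_ext n M x + linear_ext n M y" for x y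
    by (rule eq_matI) (simp_all add: linear_ext_def coord_add distrib_right sum.distrib)
  have smult: "linear_ext n M (scale k x) = k \<cdot>\<^sub>m linear_ext n M x" for k x
    by (rule eq_matI) (simp_all add: linear_ext_def coord_scale sum_distrib_left mult.assoc)
  have mult: "linear_ext n M (x * y) = linear_ext n M x * linear_ext n M y" for x y
  proof (rule eq_matI)
    fix i j assume "i < dim_row (linear_ext n M x * linear_ext n M y)"
      "j < dim_col (linear_ext n M x * linear_ext n M y)"
    then have ij: "i < n" "j < n" using carrier by (auto simp: linear_ext_def)
    let ?x = "coord scale B x" and ?y = "coord scale B y"
    have "linear_ext n M (x * y) $$ (i, j)
        = (\<Sum>d\<in>B. \<Sum>b\<in>B. \<Sum>c\<in>B. ?x b * ?y c * coord scale B (b * c) d * M d $$ (i, j))"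
      using ij by (simp add: linear_ext_def coord_mult[of x y] sum_distrib_right)
    also have "\<dots> = (\<Sum>b\<in>B. \<Sum>c\<in>B. \<Sum>d\<in>B. ?x b * ?y c * coord scale B (b * c) d * M d $$ (i, j))"
      by (rule trans[OF sum.swap]) (intro sum.cong refl sum.swap)
    also have "\<dots> = (\<Sum>b\<in>B. \<Sum>c\<in>B. ?x b * ?y c * linear_ext n M (b * c) $$ (i, j))"
      using ij by (simp add: linear_ext_def sum_distrib_left mult.assoc)
    also have "\<dots> = (\<Sum>b\<in>B. \<Sum>c\<in>B. ?x b * ?y c * (\<Sum>k<n. M b $$ (i, k) * M c $$ (k, j)))"
      using mat_mult_index[OF M M ij] by (intro sum.cong) (simp_all add: M_mult)
    also have "\<dots> = (\<Sum>b\<in>B. \<Sum>c\<in>B. \<Sum>k<n. (?x b * M b $$ (i, k)) * (?y c * M c $$ (k, j)))"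
      by (simp add: sum_distrib_left mult_ac)
    also have "\<dots> = (\<Sum>b\<in>B. \<Sum>k<n. \<Sum>c\<in>B. (?x b * M b $$ (i, k)) * (?y c * M c $$ (k, j)))"
      by (intro sum.cong refl sum.swap)
    also have "\<dots> = (\<Sum>k<n. \<Sum>b\<in>B. \<Sum>c\<in>B. (?x b * M b $$ (i, k)) * (?y c * M c $$ (k, j)))"
      by (rule sum.swap)
    also have "\<dots> = (\<Sum>k<n. linear_ext n M x $$ (i, k) * linear_ext n M y $$ (k, j))"
      using ij by (intro sum.cong) (simp_all add: linear_ext_def sum_product)
    also have "\<dots> = (linear_ext n M x * linear_ext n M y) $$ (i, j)"
      by (rule mat_mult_index[OF carrier carrier ij, symmetric])
    finally show "linear_ext n M (x * y) $$ (i, j) = (linear_ext n M x * linear_ext n M y) $$ (i, j)" .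
  qed (simp_all add: linear_ext_def)
  have "linear_ext n M 1 = 1\<^sub>m n"
    using linear_ext_basis[where M = M, OF one_in_B M[OF one_in_B]] M_one by simp
  then show ?thesis using carrier add smult mult by (simp add: matrix_rep_def)
qed

lemma mat_trace_linear_ext:
  assumes "\<And>b. b \<in> B \<Longrightarrow> M b \<in> carrier_mat n n"
  shows "mat_trace (linear_ext n M x) = (\<Sum>b\<in>B. coord scale B x b * mat_trace (M b))"
proof -
  have "mat_trace (linear_ext n M x) = (\<Sum>b\<in>B. \<Sum>i<n. coord scale B x b * M b $$ (i, i))"
    by (subst sum.swap) (simp add: mat_trace_def linear_ext_def)
  also have "\<dots> = (\<Sum>b\<in>B. coord scale B x b * mat_trace (M b))"
    using assms by (intro sum.cong) (auto simp: mat_trace_def sum_distrib_left)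
  finally show ?thesis .
qed

end

section \<open>Products with irreducible characters that are nonzero on the idempotent\<close>

context table_algebra_strongly_normal
begin

text \<open>
  The image \<open>W\<close> of $\rho(e)$ is invariant by \<open>idem_absorbs\<close> and nonzero because $\rho(e)$ has
  nonzero trace.  Irreducibility forces it to be the whole space, and a surjective idempotent is
  the identity.
\<close>

lemma irreducible_rep_idem:
  assumes rep: "matrix_rep scale n \<rho>" and irred: "irreducible_rep n \<rho>"
    and trace: "mat_trace (\<rho> e) \<noteq> 0"
  shows "\<rho> e = 1\<^sub>m n"
proof -
  note rep_simps = matrix_repD[OF rep]
  note carrier = rep_simps(1)
  define W where "W = (\<lambda>v. \<rho> e *\<^sub>v v) ` carrier_vec n"
  have W_sub: "W \<subseteq> carrier_vec n"
    using carrier[of e] by (auto simp: W_def)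
  have act: "\<rho> x *\<^sub>v (\<rho> y *\<^sub>v v) = \<rho> (x * y) *\<^sub>v v" if "v \<in> carrier_vec n" for x y v
    using assoc_mult_mat_vec[OF carrier carrier that, of x y] by (simp add: rep_simps(4))
  have "VectorSpace.subspace class_ring W (module_vec TYPE(complex) n)"
  proof (rule subspace.intro)
    show "vectorspace class_ring (module_vec TYPE(complex) n)" by (rule vec_vs)
    show "submodule class_ring W (module_vec TYPE(complex) n)"
    proof (rule submodule.intro)
      show "Module.module class_ring (module_vec TYPE(complex) n)" by (rule vec_module)
      show "W \<subseteq> carrier (module_vec TYPE(complex) n)"
        using W_sub by (simp add: module_vec_simps)
      have "\<rho> e *\<^sub>v u + \<rho> e *\<^sub>v v \<in> W" if "u \<in> carrier_vec n" "v \<in> carrier_vec n" for u v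
        using mult_add_distrib_mat_vec[OF carrier[of e] that] that
        by (auto simp: W_def intro!: image_eqI[of _ _ "u + v"])
      then show "v \<oplus>\<^bsub>module_vec TYPE(complex) n\<^esub> w \<in> W" if "v \<in> W" "w \<in> W" for v w
        using that by (auto simp: module_vec_simps W_def)
      have "\<rho> e *\<^sub>v 0\<^sub>v n = 0\<^sub>v n" using carrier[of e] by auto
      then show "\<zero>\<^bsub>module_vec TYPE(complex) n\<^esub> \<in> W"
        by (auto simp: module_vec_simps W_def intro!: image_eqI[of _ _ "0\<^sub>v n"])
      have "k \<cdot>\<^sub>v (\<rho> e *\<^sub>v v) \<in> W" if "v \<in> carrier_vec n" for k v
        using mult_mat_vec[OF carrier[of e] that, of k] that
        by (auto simp: W_def intro!: image_eqI[of _ _ "k \<cdot>\<^sub>v v"])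
      then show "c \<odot>\<^bsub>module_vec TYPE(complex) n\<^esub> v \<in> W" if "v \<in> W" for c v
        using that by (auto simp: module_vec_simps W_def)
    qed
  qed
  moreover have "\<rho> x *\<^sub>v w \<in> W" if w: "w \<in> W" for x w
  proof -
    obtain v where v: "v \<in> carrier_vec n" "w = \<rho> e *\<^sub>v v" using w by (auto simp: W_def)
    \<comment> \<open>The factor \<open>e\<close> gained on the left exhibits the vector as an element of \<open>W\<close>.\<close>
    have "\<rho> x *\<^sub>v w = \<rho> (e * (x * e)) *\<^sub>v v"
      using v idem_absorbs[of x] by (simp add: act mult.assoc)
    also have "\<dots> = \<rho> e *\<^sub>v (\<rho> (x * e) *\<^sub>v v)"
      using v by (simp add: act)
    finally show ?thesis
      using v carrier[of "x * e"] by (auto simp: W_def)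
  qed
  ultimately have "W = {0\<^sub>v n} \<or> W = carrier_vec n"
    using irred by (simp add: irreducible_rep_def)
  moreover have "W \<noteq> {0\<^sub>v n}"
  proof
    assume W: "W = {0\<^sub>v n}"
    have "\<rho> e = 0\<^sub>m n n"
    proof (rule mat_eq_by_vectors[OF carrier zero_carrier_mat])
      fix v :: "complex vec" assume v: "v \<in> carrier_vec n"
      then have "\<rho> e *\<^sub>v v \<in> W" by (simp add: W_def)
      then show "\<rho> e *\<^sub>v v = 0\<^sub>m n n *\<^sub>v v" using W v by auto
    qed
    then show False using trace by (simp add: mat_trace_def)
  qed
  ultimately have W: "W = carrier_vec n" by blast
  show ?thesis
  proof (rule mat_eq_by_vectors[OF carrier one_carrier_mat])
    fix v :: "complex vec" assume v: "v \<in> carrier_vec n"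
    then obtain u where u: "u \<in> carrier_vec n" "v = \<rho> e *\<^sub>v u" using W by (auto simp: W_def)
    then show "\<rho> e *\<^sub>v v = 1\<^sub>m n *\<^sub>v v" using v by (simp add: act idem_idem)
  qed
qed

lemma rep_span_scalar:
  assumes rep: "matrix_rep scale n \<rho>" and idem: "\<rho> e = 1\<^sub>m n" and x: "x \<in> span C"
  shows "\<rho> x = deg_map scale B deg x \<cdot>\<^sub>m 1\<^sub>m n"
proof -
  note rep_simps = matrix_repD[OF rep]
  have "\<rho> x = \<rho> x * \<rho> e" using rep_simps(1)[of x] idem by simp
  also have "\<dots> = \<rho> (scale (deg_map scale B deg x) e)"
    by (simp only: rep_simps(4)[symmetric] span_mult_idem[OF x])
  finally show ?thesis by (simp add: rep_simps(3) idem)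
qed

text \<open>
  Put $U(b) = |b|^{-1}\rho(b)$.  Elements of the span of \<open>C\<close> act by their degree, so
  \<open>triple_in_span\<close> gives $U(c^*)U(a)U(b) = 1$, and $U(c)U(c^*) = 1$ likewise.  The claim is
  $U(a)U(b) = U(c)$ for every $c$ in the support of $ab$.
\<close>

lemma rep_mult_proportional:
  assumes rep: "matrix_rep scale n \<rho>" and idem: "\<rho> e = 1\<^sub>m n"
    and a: "a \<in> B" and b: "b \<in> B" and c: "c \<in> supp scale B (a * b)"
  shows "\<rho> (a * b) = (complex_of_real (deg a * deg b) / complex_of_real (deg c)) \<cdot>\<^sub>m \<rho> c"
proof -
  note rep_simps = matrix_repD[OF rep]
  have cB: "c \<in> B" using c by (simp add: supp_def)
  let ?c = "complex_of_real (deg c)" and ?ab = "complex_of_real (deg a * deg b)"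
  have "\<rho> (star c * (a * b)) = (?c * ?ab) \<cdot>\<^sub>m 1\<^sub>m n"
    using rep_span_scalar[OF rep idem triple_in_span[OF a b c]] a b cB
    by (simp add: deg_map_mult deg_map_basis star_in_B deg_star)
  then have "\<rho> (c * (star c * (a * b))) = (?c * ?ab) \<cdot>\<^sub>m \<rho> c"
    using rep_simps(1)[of c]
    by (simp only: rep_simps(4)[of c] mult_smult_distrib[OF _ one_carrier_mat] right_mult_one_mat)
  moreover have "\<rho> (c * star c) = (?c * ?c) \<cdot>\<^sub>m 1\<^sub>m n"
    using rep_span_scalar[OF rep idem star_mult_self_in_span[OF star_in_B[OF cB]]] cB
    by (simp add: star_star deg_map_mult deg_map_basis star_in_B deg_star)
  then have "\<rho> (c * (star c * (a * b))) = (?c * ?c) \<cdot>\<^sub>m \<rho> (a * b)"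
    using rep_simps(1)[of "a * b"]
    by (simp add: rep_simps(4)[of "c * star c"] mult_smult_assoc_mat[of _ n n] flip: mult.assoc[of c])
  ultimately have eq: "(?c * ?c) \<cdot>\<^sub>m \<rho> (a * b) = (?c * ?ab) \<cdot>\<^sub>m \<rho> c" by simp
  show ?thesis
  proof (rule eq_matI)
    fix i j assume "i < dim_row ((?ab / ?c) \<cdot>\<^sub>m \<rho> c)" "j < dim_col ((?ab / ?c) \<cdot>\<^sub>m \<rho> c)"
    then have ij: "i < n" "j < n" using rep_simps(1)[of c] by auto
    have "((?c * ?c) \<cdot>\<^sub>m \<rho> (a * b)) $$ (i, j) = ((?c * ?ab) \<cdot>\<^sub>m \<rho> c) $$ (i, j)"
      by (simp only: eq)
    then have "?c * ?c * \<rho> (a * b) $$ (i, j) = ?c * ?ab * \<rho> c $$ (i, j)"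
      using ij rep_simps(1)[of c] rep_simps(1)[of "a * b"] by auto
    then show "\<rho> (a * b) $$ (i, j) = ((?ab / ?c) \<cdot>\<^sub>m \<rho> c) $$ (i, j)"
      using ij rep_simps(1)[of c] deg_ne_0[OF cB] by (auto simp: field_simps)
  qed (use rep_simps(1)[of c] rep_simps(1)[of "a * b"] in auto)
qed

text \<open>
  For $U(b) = |b|^{-1}\rho(b)$ and basis elements $a, b$, each $c$ that occurs in $ab$ satisfies
  $U(c) = U(a)U(b)$.  The common factor leaves the sum:
  $\sum_c \lambda_{abc}\,U(c) \otimes \sigma(c) = U(a)U(b) \otimes \sigma(ab)$,
  which is the product of $U(a) \otimes \sigma(a)$ and $U(b) \otimes \sigma(b)$.
\<close>

lemma matrix_rep_twisted_kronecker:
  assumes rep: "matrix_rep scale n \<rho>" and idem: "\<rho> e = 1\<^sub>m n" and rep': "matrix_rep scale m \<sigma>"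
  defines "M \<equiv> \<lambda>b. kronecker ((1 / complex_of_real (deg b)) \<cdot>\<^sub>m \<rho> b) (\<sigma> b)"
  shows "matrix_rep scale (n * m) (linear_ext (n * m) M)"
proof (rule matrix_rep_linear_ext)
  note rs = matrix_repD[OF rep] and ss = matrix_repD[OF rep']
  have U: "(1 / complex_of_real (deg b)) \<cdot>\<^sub>m \<rho> b \<in> carrier_mat n n" for b
    using rs(1)[of b] by simp
  show "M b \<in> carrier_mat (n * m) (n * m)" for b
    unfolding M_def by (rule kronecker_carrier[OF U ss(1)])
  have "1 \<cdot>\<^sub>m 1\<^sub>m n = (1\<^sub>m n :: complex mat)" by (rule eq_matI) auto
  then show "M 1 = 1\<^sub>m (n * m)"
    by (simp add: M_def deg_one rs(5) ss(5) kronecker_one)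
  fix a b assume a: "a \<in> B" and b: "b \<in> B"
  let ?k = "1 / complex_of_real (deg a * deg b)"
  have ab: "?k \<cdot>\<^sub>m \<rho> (a * b) \<in> carrier_mat n n" using rs(1) by simp
  let ?a = "1 / complex_of_real (deg a)" and ?b = "1 / complex_of_real (deg b)"
  have "(?a \<cdot>\<^sub>m \<rho> a) * (?b \<cdot>\<^sub>m \<rho> b) = ?a \<cdot>\<^sub>m (?b \<cdot>\<^sub>m \<rho> (a * b))"
    by (simp only: mult_smult_assoc_mat[OF rs(1) U] mult_smult_distrib[OF rs(1) rs(1)] rs(4))
  also have "\<dots> = ?k \<cdot>\<^sub>m \<rho> (a * b)"
    by (rule eq_matI) auto
  finally have UU: "(?a \<cdot>\<^sub>m \<rho> a) * (?b \<cdot>\<^sub>m \<rho> b) = ?k \<cdot>\<^sub>m \<rho> (a * b)" .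
  have "M a * M b = kronecker (?k \<cdot>\<^sub>m \<rho> (a * b)) (\<sigma> (a * b))"
    unfolding M_def kronecker_mult[OF U U ss(1) ss(1)] UU ss(4) ..
  moreover have "linear_ext (n * m) M (a * b) = kronecker (?k \<cdot>\<^sub>m \<rho> (a * b)) (\<sigma> (a * b))"
  proof (rule eq_matI)
    fix i j assume "i < dim_row (kronecker (?k \<cdot>\<^sub>m \<rho> (a * b)) (\<sigma> (a * b)))"
      "j < dim_col (kronecker (?k \<cdot>\<^sub>m \<rho> (a * b)) (\<sigma> (a * b)))"
    then have ij: "i < n * m" "j < n * m" using kronecker_carrier[OF ab ss(1)[of "a * b"]] by auto
    note dm = div_mod_less[OF ij(1)] div_mod_less[OF ij(2)]
    let ?r = "\<lambda>x. \<rho> x $$ (i div m, j div m)" and ?s = "\<lambda>x. \<sigma> x $$ (i mod m, j mod m)"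
    have summand: "coord scale B (a * b) c * M c $$ (i, j) = ?k * ?r (a * b) * (coord scale B (a * b) c * ?s c)"
      if c: "c \<in> B" for c
    proof (cases "coord scale B (a * b) c = 0")
      case False
      then have "c \<in> supp scale B (a * b)" using c by (simp add: supp_def)
      then have "\<rho> (a * b) = (complex_of_real (deg a * deg b) / complex_of_real (deg c)) \<cdot>\<^sub>m \<rho> c"
        by (rule rep_mult_proportional[OF rep idem a b])
      then have "?r (a * b) = ((complex_of_real (deg a * deg b) / complex_of_real (deg c)) \<cdot>\<^sub>m \<rho> c)
          $$ (i div m, j div m)"
        by (rule arg_cong)
      also have "\<dots> = complex_of_real (deg a * deg b) / complex_of_real (deg c) * ?r c"
        using rs(1)[of c] dm by (intro index_smult_mat) auto
      finally have "?r (a * b) = complex_of_real (deg a * deg b) / complex_of_real (deg c) * ?r c" .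
      moreover have "M c $$ (i, j) = 1 / complex_of_real (deg c) * ?r c * ?s c"
        using rs(1)[of c] dm unfolding M_def kronecker_index[OF U ss(1) ij] by auto
      ultimately show ?thesis using deg_ne_0[OF a] deg_ne_0[OF b] by simp
    qed simp
    have "linear_ext (n * m) M (a * b) $$ (i, j) = (\<Sum>c\<in>B. coord scale B (a * b) c * M c $$ (i, j))"
      using ij by (simp add: linear_ext_def)
    also have "\<dots> = ?k * ?r (a * b) * (\<Sum>c\<in>B. coord scale B (a * b) c * ?s c)"
      by (simp only: summand sum_distrib_left cong: sum.cong)
    also have "\<dots> = ?k * ?r (a * b) * ?s (a * b)"
      by (simp only: matrix_rep_index[OF rep' dm(2,4), of "a * b"])
    also have "\<dots> = kronecker (?k \<cdot>\<^sub>m \<rho> (a * b)) (\<sigma> (a * b)) $$ (i, j)"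
      using rs(1)[of "a * b"] dm unfolding kronecker_index[OF ab ss(1) ij] by auto
    finally show "linear_ext (n * m) M (a * b) $$ (i, j)
        = kronecker (?k \<cdot>\<^sub>m \<rho> (a * b)) (\<sigma> (a * b)) $$ (i, j)" .
  qed (use kronecker_carrier[OF ab ss(1)[of "a * b"]] in \<open>auto simp: linear_ext_def\<close>)
  ultimately show "linear_ext (n * m) M (a * b) = M a * M b" by (simp only:)
qed

end

theorem theorem4p3:
  fixes scale :: "complex \<Rightarrow> 'a::ring_1 \<Rightarrow> 'a"
    and B C :: "'a set"
    and star :: "'a \<Rightarrow> 'a"
    and deg :: "'a \<Rightarrow> real"
    and \<chi> \<psi> :: "'a \<Rightarrow> complex"
  assumes "table_algebra scale B star deg"
    and "strongly_normal scale B star C"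
    and "is_irreducible_character scale \<chi>"
    and "\<chi> (closed_idem scale B deg C) \<noteq> 0"
    and "is_character scale \<psi>"
  shows "is_character scale (char_prod scale B deg \<chi> \<psi>)"
proof -
  interpret table_algebra scale B star deg by fact
  interpret table_algebra_strongly_normal scale B star deg C
    by unfold_locales (use assms(2) in \<open>simp_all add: strongly_normal_def\<close>)
  obtain n \<rho> where rep: "matrix_rep scale n \<rho>" and irred: "irreducible_rep n \<rho>"
    and \<chi>: "\<chi> = (\<lambda>x. mat_trace (\<rho> x))"
    using assms(3) by (auto simp: is_irreducible_character_def)
  obtain m \<sigma> where rep': "matrix_rep scale m \<sigma>" and \<psi>: "\<psi> = (\<lambda>x. mat_trace (\<sigma> x))"
    using assms(5) by (auto simp: is_character_def)
  have idem: "\<rho> e = 1\<^sub>m n"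
    using irreducible_rep_idem[OF rep irred] assms(4) by (simp add: \<chi>)
  define M where "M = (\<lambda>b. kronecker ((1 / complex_of_real (deg b)) \<cdot>\<^sub>m \<rho> b) (\<sigma> b))"
  have U: "(1 / complex_of_real (deg b)) \<cdot>\<^sub>m \<rho> b \<in> carrier_mat n n" for b
    using matrix_repD(1)[OF rep, of b] by simp
  have M: "M b \<in> carrier_mat (n * m) (n * m)" for b
    unfolding M_def by (rule kronecker_carrier[OF U matrix_repD(1)[OF rep']])
  have "mat_trace (M b) = 1 / complex_of_real (deg b) * \<chi> b * \<psi> b" for b
    using matrix_repD(1)[OF rep, of b]
    unfolding M_def kronecker_trace[OF U matrix_repD(1)[OF rep']]
    by (auto simp: \<chi> \<psi> mat_trace_def sum_distrib_left)
  then have "char_prod scale B deg \<chi> \<psi> = (\<lambda>x. mat_trace (linear_ext (n * m) M x))"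
    by (simp add: fun_eq_iff char_prod_def mat_trace_linear_ext[OF M])
  moreover have "matrix_rep scale (n * m) (linear_ext (n * m) M)"
    unfolding M_def by (rule matrix_rep_twisted_kronecker[OF rep idem rep'])
  ultimately show ?thesis by (auto simp: is_character_def)
qed

end
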